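(* Let $\lambda$ be a nonzero real number. For all integers $n,r\ge0$ and every $x$, $$ \sum_{k=0}^{n}(k)_{r,\lambda}x^{k}=\sum_{j=0}^{r}j!{r \brace j}_{\lambda}\sum_{k=0}^{n}\binom{k}{j}x^{k}. $$ In particular, $$ \sum_{k=0}^{n}(k)_{r,\lambda}=\sum_{j=0}^{r}j!\binom{n+1}{j+1}{r \brace j}_{\lambda}. $$
   Context: For a real parameter $\mu$ the degenerate falling factorials are $(x)_{0,\mu}=1$ and $(x)_{n,\mu}=x(x-\mu)\cdots(x-(n-1)\mu)$ for $n\ge1$; $(x)_n=(x)_{n,1}$ is the usual falling factorial and $\binom{y}{m}=(y)_m/m!$. The degenerate Stirling numbers of the second kind ${n \brace k}_{\mu}$ are defined by $(x)_{n,\mu}=\sum_{k=0}^{n}{n \brace k}_{\mu}(x)_k$. *)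

theory Defs
  imports Complex_Main
begin

definition deg_ffact :: "real \<Rightarrow> nat \<Rightarrow> real \<Rightarrow> real" where
  "deg_ffact x n \<mu> = (\<Prod>i<n. x - real i * \<mu>)"

abbreviation ffact :: "real \<Rightarrow> nat \<Rightarrow> real" where
  "ffact x n \<equiv> deg_ffact x n 1"

text \<open>The defining expansion only determines the numbers with \<open>k \<le> n\<close>; they are extended by
  \<open>0\<close> for \<open>k > n\<close>, so that there is exactly one coefficient function
  (see \<open>ex1_deg_stirling2\<close> below).\<close>

definition is_deg_stirling2 :: "real \<Rightarrow> nat \<Rightarrow> (nat \<Rightarrow> real) \<Rightarrow> bool" where
  "is_deg_stirling2 \<mu> n S \<longleftrightarrow>
     (\<forall>x. deg_ffact x n \<mu> = (\<Sum>k=0..n. S k * ffact x k)) \<and> (\<forall>k>n. S k = 0)"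

definition deg_stirling2 :: "real \<Rightarrow> nat \<Rightarrow> nat \<Rightarrow> real" where
  "deg_stirling2 \<mu> n = (THE S. is_deg_stirling2 \<mu> n S)"

lemma deg_ffact_0 [simp]: "deg_ffact x 0 \<mu> = 1"
  by (simp add: deg_ffact_def)

lemma deg_ffact_Suc: "deg_ffact x (Suc n) \<mu> = deg_ffact x n \<mu> * (x - real n * \<mu>)"
  by (simp add: deg_ffact_def)

lemma ffact_of_nat_eq_0: "m < k \<Longrightarrow> ffact (real m) k = 0"
  by (auto simp: deg_ffact_def)

lemma ffact_of_nat_self_neq_0: "ffact (real m) m \<noteq> 0"
  by (auto simp: deg_ffact_def)

lemma is_deg_stirling2_exists: "\<exists>S. is_deg_stirling2 \<mu> n S"
proof (induction n)
  case 0
  show ?case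
    by (rule exI[of _ "\<lambda>k. if k = 0 then 1 else 0"]) (auto simp: is_deg_stirling2_def)
next
  case (Suc n)
  then obtain S where S: "\<And>x. deg_ffact x n \<mu> = (\<Sum>k=0..n. S k * ffact x k)"
    and S0: "\<And>k. k > n \<Longrightarrow> S k = 0"
    by (auto simp: is_deg_stirling2_def)
  define T where "T k = (case k of 0 \<Rightarrow> 0 | Suc j \<Rightarrow> S j) + (real k - real n * \<mu>) * S k" for k
  have "deg_ffact x (Suc n) \<mu> = (\<Sum>k=0..Suc n. T k * ffact x k)" for x
  proof -
    have "deg_ffact x (Suc n) \<mu> = (\<Sum>k=0..n. S k * ffact x k * (x - real n * \<mu>))"
      by (simp add: deg_ffact_Suc S sum_distrib_right)
    also have "\<dots> = (\<Sum>k=0..n. S k * ffact x (Suc k) + (real k - real n * \<mu>) * S k * ffact x k)"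
      by (intro sum.cong refl) (simp add: deg_ffact_Suc algebra_simps)
    also have "\<dots> = (\<Sum>k=0..n. S k * ffact x (Suc k))
        + (\<Sum>k=0..n. (real k - real n * \<mu>) * S k * ffact x k)"
      by (rule sum.distrib)
    also have "(\<Sum>k=0..n. S k * ffact x (Suc k))
        = (\<Sum>k=0..Suc n. (case k of 0 \<Rightarrow> 0 | Suc j \<Rightarrow> S j) * ffact x k)"
      by (simp add: sum.atLeast0_atMost_Suc_shift del: sum.cl_ivl_Suc)
    also have "(\<Sum>k=0..n. (real k - real n * \<mu>) * S k * ffact x k)
        = (\<Sum>k=0..Suc n. (real k - real n * \<mu>) * S k * ffact x k)"
      by (simp add: S0)
    finally show ?thesis
      by (simp add: T_def sum.distrib distrib_right del: sum.cl_ivl_Suc)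
  qed
  moreover have "T k = 0" if "k > Suc n" for k
    using that by (auto simp: T_def S0 split: nat.splits)
  ultimately show ?case
    by (auto simp: is_deg_stirling2_def)
qed

lemma is_deg_stirling2_unique:
  assumes "is_deg_stirling2 \<mu> n S" and "is_deg_stirling2 \<mu> n T"
  shows "S = T"
proof
  fix m
  have eq: "(\<Sum>k=0..n. S k * ffact x k) = (\<Sum>k=0..n. T k * ffact x k)" for x
    using assms by (simp add: is_deg_stirling2_def)
  show "S m = T m"
  proof (induction m rule: less_induct)
    case (less m)
    show ?case
    proof (cases "m \<le> n")
      case True
      have split: "(\<Sum>k=0..n. U k * ffact (real m) k)
          = (\<Sum>k<m. U k * ffact (real m) k) + U m * ffact (real m) m" for U
      proof -
        have "(\<Sum>k=0..n. U k * ffact (real m) k) = (\<Sum>k\<le>m. U k * ffact (real m) k)"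
          using True by (intro sum.mono_neutral_right) (auto simp: ffact_of_nat_eq_0)
        then show ?thesis
          by (simp add: lessThan_Suc_atMost[symmetric])
      qed
      have "(\<Sum>k<m. S k * ffact (real m) k) = (\<Sum>k<m. T k * ffact (real m) k)"
        using less by (intro sum.cong) auto
      then show ?thesis
        using eq[of "real m"] ffact_of_nat_self_neq_0[of m] by (simp add: split)
    next
      case False
      then show ?thesis
        using assms by (simp add: is_deg_stirling2_def)
    qed
  qed
qed

lemma ex1_deg_stirling2: "\<exists>!S. is_deg_stirling2 \<mu> n S"
  using is_deg_stirling2_exists is_deg_stirling2_unique by blast

lemma is_deg_stirling2_deg_stirling2: "is_deg_stirling2 \<mu> n (deg_stirling2 \<mu> n)"
  unfolding deg_stirling2_def by (rule theI'[OF ex1_deg_stirling2])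

lemma deg_ffact_eq_sum_deg_stirling2:
  "deg_ffact x n \<mu> = (\<Sum>k=0..n. deg_stirling2 \<mu> n k * ffact x k)"
  using is_deg_stirling2_deg_stirling2[of \<mu> n] unfolding is_deg_stirling2_def by blast

end

theory Submission
  imports Defs
begin

text \<open>Since \<open>ffact y j\<close> is \<open>fact j\<close> times a binomial coefficient,
  the defining expansion of the degenerate Stirling numbers becomes an expansion in binomials
  (\<open>deg_ffact_eq_sum_gbinomial\<close>). Evaluating it at y = k, weighting by
  \<open>x ^ k\<close> and exchanging the two finite sums gives the first identity; at x = 1 the
  inner sums are evaluated by the hockey-stick identity.\<close>

lemma ffact_eq_fact_mult_gbinomial: "ffact y j = fact j * (y gchoose j)"
  by (simp add: deg_ffact_def gbinomial_prod_rev atLeast0LessThan)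

lemma deg_ffact_eq_sum_gbinomial:
  "deg_ffact y r \<mu> = (\<Sum>j=0..r. fact j * deg_stirling2 \<mu> r j * (y gchoose j))"
  by (simp add: deg_ffact_eq_sum_deg_stirling2[of y] ffact_eq_fact_mult_gbinomial mult_ac)

text \<open>The coefficients are real and enter through \<open>of_real\<close>, so that x may be
  real or complex; as \<open>of_real\<close> respects sums and products, the real expansion
  transfers termwise.\<close>

lemma sum_deg_ffact_mult_power:
  fixes x :: "'a::real_field"
  shows "(\<Sum>k=0..n. of_real (deg_ffact (real k) r \<mu>) * x ^ k)
    = (\<Sum>j=0..r. of_real (fact j * deg_stirling2 \<mu> r j)
        * (\<Sum>k=0..n. of_real (real k gchoose j) * x ^ k))"
proof -
  have "(\<Sum>k=0..n. of_real (deg_ffact (real k) r \<mu>) * x ^ k)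
    = (\<Sum>k=0..n. \<Sum>j=0..r. of_real (fact j * deg_stirling2 \<mu> r j)
        * (of_real (real k gchoose j) * x ^ k))"
    by (simp only: deg_ffact_eq_sum_gbinomial of_real_sum of_real_mult sum_distrib_right mult.assoc)
  also have "\<dots> = (\<Sum>j=0..r. \<Sum>k=0..n. of_real (fact j * deg_stirling2 \<mu> r j)
        * (of_real (real k gchoose j) * x ^ k))"
    by (rule sum.swap)
  finally show ?thesis
    by (simp only: sum_distrib_left)
qed

lemma sum_deg_ffact:
  "(\<Sum>k=0..n. deg_ffact (real k) r \<mu>)
    = (\<Sum>j=0..r. fact j * (real (n + 1) gchoose (j + 1)) * deg_stirling2 \<mu> r j)"
proof -
  have "(\<Sum>k=0..n. deg_ffact (real k) r \<mu>)
    = (\<Sum>j=0..r. fact j * deg_stirling2 \<mu> r j * (\<Sum>k=0..n. real k gchoose j))"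
    \<comment> \<open>At the real point x = 1 all powers and embeddings disappear.\<close>
    using sum_deg_ffact_mult_power[of r \<mu> "1::real" n] by simp
  also have "\<dots> = (\<Sum>j=0..r. fact j * (real (n + 1) gchoose (j + 1)) * deg_stirling2 \<mu> r j)"
    \<comment> \<open>\<open>gbinomial_sum_up_index\<close> is the hockey-stick identity, which
      raises both indices by one.\<close>
    by (intro sum.cong refl) (simp add: gbinomial_sum_up_index add.commute)
  finally show ?thesis .
qed

theorem theorem2p15:
  fixes lam :: real and n r :: nat and x :: "'a::real_field"
  assumes "lam \<noteq> 0"
  shows "(\<Sum>k=0..n. of_real (deg_ffact (real k) r lam) * x ^ k)
           = (\<Sum>j=0..r. of_real (fact j * deg_stirling2 lam r j)
                * (\<Sum>k=0..n. of_real (real k gchoose j) * x ^ k))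
       \<and> (\<Sum>k=0..n. deg_ffact (real k) r lam)
           = (\<Sum>j=0..r. fact j * (real (n + 1) gchoose (j + 1)) * deg_stirling2 lam r j)"
  using sum_deg_ffact_mult_power sum_deg_ffact by (rule conjI)

end
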